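(* Let $\lambda\in(\frac16,\frac56)$. Then the graph $\mathrm{Gr}(F^\lambda)=\{(x,F^\lambda(x)):x\in[0,1]\}$ is not a self-similar compact subset of $\mathbb R^2$: there is no finite family $\{\Phi_i:\mathbb R^2\to\mathbb R^2\}_{i=1,\dots,N}$ of contracting similarities such that $\mathrm{Gr}(F^\lambda)=\bigcup_{i=1}^N\Phi_i(\mathrm{Gr}(F^\lambda))$.
   Context: Fix $\lambda>0$. Piecewise affine functions $F^\lambda_n:[0,1]\to\mathbb R$ are defined recursively. $F^\lambda_0\equiv0$, affine on the single interval $[0,1]$ (of generation $0$). Given $F^\lambda_n$ with its $4^n$ closed intervals of generation $n$ (covering $[0,1]$, disjoint interiors, $F^\lambda_n$ affine on each), on each interval $[a,b]$ of generation $n$, with $\ell=b-a$ and $m$ the slope of $F^\lambda_n$ there, $F^\lambda_{n+1}$ coincides with $F^\lambda_n$ at $a$, $a+\ell/3$, $a+2\ell/3$, $b$, equals $F^\lambda_n(a+\ell/2)+\lambda\ell\sqrt{1+m^2}$ at $a+\ell/2$, and is affine on each of $[a,a+\ell/3]$, $[a+\ell/3,a+\ell/2]$, $[a+\ell/2,a+2\ell/3]$, $[a+2\ell/3,b]$ (the intervals of generation $n+1$). The sequence $(F^\lambda_n(x))_n$ is nondecreasing and $F^\lambda(x):=\lim_n F^\lambda_n(x)$; for $\lambda\in(\frac16,\frac56)$ this limit is finite and $F^\lambda$ is continuous. *)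

theory Defs
  imports "HOL-Analysis.Analysis"
begin

text \<open>The graph of F_n is encoded by the list of its vertices (x, F_n(x)) at the
endpoints of the generation-n intervals, in increasing order of x.
One refinement step replaces each interval [a,b] (length l, slope m) by the
four intervals with breakpoints a, a+l/3, a+l/2, a+2l/3, b, keeping the
values of F_n at a, a+l/3, a+2l/3, b and raising the midpoint by
lambda * l * sqrt(1+m^2).\<close>

fun refine_step :: "real \<Rightarrow> (real \<times> real) list \<Rightarrow> (real \<times> real) list" where
  "refine_step lam ((a, ya) # (b, yb) # ps) =
     (let l = b - a; m = (yb - ya) / l in
       (a, ya) # (a + l/3, ya + m * (l/3))
       # (a + l/2, ya + m * (l/2) + lam * l * sqrt (1 + m^2))
       # (a + 2*l/3, ya + m * (2*l/3))
       # refine_step lam ((b, yb) # ps))"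
| "refine_step lam ps = ps"

fun interp :: "(real \<times> real) list \<Rightarrow> real \<Rightarrow> real" where
  "interp ((a, ya) # (b, yb) # ps) x =
     (if x \<le> b then ya + (yb - ya) / (b - a) * (x - a) else interp ((b, yb) # ps) x)"
| "interp [(a, ya)] x = ya"
| "interp [] x = 0"

definition vertices :: "real \<Rightarrow> nat \<Rightarrow> (real \<times> real) list" where
  "vertices lam n = (refine_step lam ^^ n) [(0, 0), (1, 0)]"

definition Fn :: "real \<Rightarrow> nat \<Rightarrow> real \<Rightarrow> real" where
  "Fn lam n x = interp (vertices lam n) x"

definition F :: "real \<Rightarrow> real \<Rightarrow> real" where
  "F lam x = lim (\<lambda>n. Fn lam n x)"

definition graph_F :: "real \<Rightarrow> (real \<times> real) set" where
  "graph_F lam = {(x, F lam x) | x. x \<in> {0..1}}"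

text \<open>Contracting similarity of the Euclidean plane (real \<times> real carries the Euclidean metric).\<close>
definition contracting_similarity :: "(real \<times> real \<Rightarrow> real \<times> real) \<Rightarrow> bool" where
  "contracting_similarity \<Phi> \<longleftrightarrow>
     (\<exists>r. 0 < r \<and> r < 1 \<and> (\<forall>p q. dist (\<Phi> p) (\<Phi> q) = r * dist p q))"

end

theory Submission
  imports Defs
begin

text \<open>Around the point \<open>2/5\<close> there are intervals of generation \<open>n\<close> on which the slope of \<open>F\<^sub>n\<close> is at
  least \<open>6 * lam * n\<close>; since \<open>6 * lam > 1\<close>, the next generation contains arbitrarily steep descending
  intervals as well. By continuity of \<open>F\<close> every real number is therefore the slope of a secant of the
  graph. A similarity that maps the graph into itself must preserve the vertical direction, for
  otherwise it would make some secant vertical; hence it scales abscissas and increments of \<open>F\<close> by the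
  same factor. Iterating a self-similar decomposition gives arbitrarily short intervals \<open>I\<close> around
  \<open>2/5\<close> on which \<open>F\<close> oscillates by at most a constant times the length of \<open>I\<close>, which contradicts the
  steepness at \<open>2/5\<close>.\<close>

section \<open>Vertex lists under refinement: edge lengths and interpolation\<close>

lemma refine_step_Cons: "\<exists>qs. refine_step lam (p # ps) = p # qs"
  by (cases p; cases ps) (auto simp: Let_def split: prod.splits)

text \<open>The factor \<open>l * sqrt (1 + m^2)\<close> is the Euclidean length of the edge, so the
  raise of the midpoint is \<open>lam\<close> times a distance; this form is free of slopes.\<close>

lemma refine_step_pair:
  assumes "a < b"
  shows "refine_step lam ((a, ya) # (b, yb) # ps) =
    (a, ya) # (a + (b - a) / 3, ya + (yb - ya) / 3)
    # (a + (b - a) / 2, ya + (yb - ya) / 2 + lam * dist (a, ya) (b, yb))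
    # (a + 2 * (b - a) / 3, ya + 2 * (yb - ya) / 3)
    # refine_step lam ((b, yb) # ps)"
proof -
  have "(b - a) * sqrt (1 + ((yb - ya) / (b - a))\<^sup>2) = sqrt ((b - a)\<^sup>2 * (1 + ((yb - ya) / (b - a))\<^sup>2))"
    using assms by (simp add: real_sqrt_mult)
  also have "(b - a)\<^sup>2 * (1 + ((yb - ya) / (b - a))\<^sup>2) = (b - a)\<^sup>2 + (yb - ya)\<^sup>2"
    using assms by (simp add: field_simps)
  also have "sqrt \<dots> = dist (a, ya) (b, yb)"
    by (simp add: dist_Pair_Pair dist_real_def power2_commute)
  finally show ?thesis
    using assms by (simp add: Let_def mult.assoc)
qed

declare refine_step.simps(1) [simp del]

text \<open>Each inner edge is a sixth of the old edge plus or minus the vertical vector of length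
  \<open>lam * d\<close>, so the triangle inequality applies; the outer edges are exact
  thirds.\<close>

lemma dist_tent:
  fixes a b ya yb lam :: real
  assumes "lam \<ge> 0"
  defines "d \<equiv> dist (a, ya) (b, yb)"
  shows "dist (a + (b - a) / 3, ya + (yb - ya) / 3)
      (a + (b - a) / 2, ya + (yb - ya) / 2 + lam * d) \<le> (1/6 + lam) * d"
    and "dist (a + (b - a) / 2, ya + (yb - ya) / 2 + lam * d)
      (a + 2 * (b - a) / 3, ya + 2 * (yb - ya) / 3) \<le> (1/6 + lam) * d"
    and "dist (a, ya) (a + (b - a) / 3, ya + (yb - ya) / 3) = d / 3"
    and "dist (a + 2 * (b - a) / 3, ya + 2 * (yb - ya) / 3) (b, yb) = d / 3"
proof -
  have d: "d = norm (b - a, yb - ya)"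
    by (simp add: d_def dist_norm norm_minus_commute flip: norm_minus_cancel[of "(b - a, yb - ya)"])
  have d0: "d \<ge> 0" by (simp add: d)
  have sc: "norm (c * (b - a), c * (yb - ya)) = \<bar>c\<bar> * d" for c
    using norm_scaleR[of c "(b - a, yb - ya)"] by (simp add: d)
  have v: "norm (0 :: real, lam * d) = lam * d"
    using assms(1) d0 by (simp add: norm_Pair)
  have "(a + (b - a) / 3, ya + (yb - ya) / 3) - (a + (b - a) / 2, ya + (yb - ya) / 2 + lam * d)
      = (-1/6 * (b - a), -1/6 * (yb - ya)) - (0, lam * d)"
    by (simp add: field_simps)
  then show "dist (a + (b - a) / 3, ya + (yb - ya) / 3)
      (a + (b - a) / 2, ya + (yb - ya) / 2 + lam * d) \<le> (1/6 + lam) * d"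
    using norm_triangle_ineq4[of "(-1/6 * (b - a), -1/6 * (yb - ya))" "(0, lam * d)"]
    unfolding dist_norm by (simp only: sc v) (simp add: algebra_simps)
  have "(a + (b - a) / 2, ya + (yb - ya) / 2 + lam * d) - (a + 2 * (b - a) / 3, ya + 2 * (yb - ya) / 3)
      = (-1/6 * (b - a), -1/6 * (yb - ya)) + (0, lam * d)"
    by (simp add: field_simps)
  then show "dist (a + (b - a) / 2, ya + (yb - ya) / 2 + lam * d)
      (a + 2 * (b - a) / 3, ya + 2 * (yb - ya) / 3) \<le> (1/6 + lam) * d"
    using norm_triangle_ineq[of "(-1/6 * (b - a), -1/6 * (yb - ya))" "(0, lam * d)"]
    unfolding dist_norm by (simp only: sc v) (simp add: algebra_simps)
  have "(a, ya) - (a + (b - a) / 3, ya + (yb - ya) / 3) = (-1/3 * (b - a), -1/3 * (yb - ya))"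
    by (simp add: field_simps)
  then show "dist (a, ya) (a + (b - a) / 3, ya + (yb - ya) / 3) = d / 3"
    unfolding dist_norm by (simp only: sc)
  have "(a + 2 * (b - a) / 3, ya + 2 * (yb - ya) / 3) - (b, yb) = (-1/3 * (b - a), -1/3 * (yb - ya))"
    by (simp add: field_simps)
  then show "dist (a + 2 * (b - a) / 3, ya + 2 * (yb - ya) / 3) (b, yb) = d / 3"
    unfolding dist_norm by (simp only: sc)
qed

text \<open>The bound concerns Euclidean edge length rather than width, because the next raise is
  proportional to that length.\<close>

definition mesh :: "real \<Rightarrow> (real \<times> real) list \<Rightarrow> bool" where
  "mesh H = successively (\<lambda>p q. fst p < fst q \<and> dist p q \<le> H)"

lemma mesh_simps [simp]:
  "mesh H []" "mesh H [p]"
  "mesh H (p # q # ps) \<longleftrightarrow> fst p < fst q \<and> dist p q \<le> H \<and> mesh H (q # ps)"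
  by (simp_all add: mesh_def)

text \<open>By \<open>dist_tent\<close> the inner edges shrink by \<open>1/6 + lam\<close>, and
  \<open>lam >= 1/6\<close> makes this factor at least the \<open>1/3\<close> of the outer edges. It
  is below 1 exactly when \<open>lam < 5/6\<close>.\<close>

lemma mesh_refine_step:
  assumes "lam \<ge> 1/6"
  shows "mesh H ps \<Longrightarrow> mesh ((1/6 + lam) * H) (refine_step lam ps)"
proof (induction ps rule: induct_list012)
  case (3 p q ps)
  obtain a ya b yb where p: "p = (a, ya)" and q: "q = (b, yb)" by fastforce
  obtain qs where qs: "refine_step lam (q # ps) = q # qs" using refine_step_Cons by blast
  have ab: "a < b" and d: "dist p q \<le> H" and IH: "mesh ((1/6 + lam) * H) (q # qs)"
    using 3 p q qs by auto
  have 1: "(1/6 + lam) * dist p q \<le> (1/6 + lam) * H"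
    using d assms by (intro mult_left_mono) auto
  have 2: "1 / 3 * dist p q \<le> (1/6 + lam) * dist p q"
    using assms by (intro mult_right_mono) auto
  have lam: "lam \<ge> 0" using assms by simp
  note tent = dist_tent[where lam = lam and a = a and b = b and ya = ya and yb = yb, OF lam]
  have "a < a + (b - a) / 3" "a + (b - a) / 3 < a + (b - a) / 2"
    "a + (b - a) / 2 < a + 2 * (b - a) / 3" "a + 2 * (b - a) / 3 < b"
    using ab by (simp_all add: field_simps)
  moreover have "dist (a, ya) (a + (b - a) / 3, ya + (yb - ya) / 3) \<le> (1/6 + lam) * H"
    "dist (a + 2 * (b - a) / 3, ya + 2 * (yb - ya) / 3) (b, yb) \<le> (1/6 + lam) * H"
    using 1 2 tent(3,4) unfolding p q by linarith+
  ultimately show ?case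
    using 1 tent(1,2) IH
    unfolding p q refine_step_pair[OF ab] qs[unfolded q] mesh_simps fst_conv
    by (meson order_trans)
qed auto

lemma set_refine_step:
  "mesh H ps \<Longrightarrow> set ps \<subseteq> set (refine_step lam ps)"
proof (induction ps rule: induct_list012)
  case (3 p q ps)
  obtain a ya b yb where "p = (a, ya)" and "q = (b, yb)" by fastforce
  with 3 show ?case by (auto simp: refine_step_pair)
qed auto

definition adj :: "(real \<times> real) list \<Rightarrow> ((real \<times> real) \<times> (real \<times> real)) set" where
  "adj ps = set (zip ps (tl ps))"

lemma adj_Cons_Cons [simp]: "adj (p # q # ps) = insert (p, q) (adj (q # ps))"
  by (simp add: adj_def)

text \<open>Of the four new edges only the second is recorded as an edge, since the nested intervals
  around \<open>2/5\<close> always descend into that one.\<close>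

lemma adj_refine_step:
  assumes "((a, ya), (b, yb)) \<in> adj ps" and "mesh H ps"
  shows "{(a, ya), (a + (b - a) / 3, ya + (yb - ya) / 3),
           (a + (b - a) / 2, ya + (yb - ya) / 2 + lam * dist (a, ya) (b, yb)),
           (a + 2 * (b - a) / 3, ya + 2 * (yb - ya) / 3), (b, yb)}
         \<subseteq> set (refine_step lam ps)" (is "?A ps")
    and "((a + (b - a) / 3, ya + (yb - ya) / 3),
          (a + (b - a) / 2, ya + (yb - ya) / 2 + lam * dist (a, ya) (b, yb)))
         \<in> adj (refine_step lam ps)" (is "?B ps")
proof -
  have "?A ps \<and> ?B ps"
    using assms
  proof (induction ps rule: induct_list012)
    case (3 p q ps)
    obtain a' ya' b' yb' where p: "p = (a', ya')" and q: "q = (b', yb')" by fastforce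
    obtain qs where qs: "refine_step lam ((b', yb') # ps) = (b', yb') # qs"
      using refine_step_Cons by blast
    have ab: "a' < b'" using 3 p q by auto
    show ?case
    proof (cases "((a, ya), (b, yb)) = (p, q)")
      case True
      then show ?thesis using p q by (auto simp: refine_step_pair[OF ab] qs)
    next
      case False
      then have "((a, ya), (b, yb)) \<in> adj (q # ps)" "mesh H (q # ps)"
        using 3 by auto
      from "3.IH"(2)[OF this] show ?thesis
        unfolding p q refine_step_pair[OF ab] qs by auto
    qed
  qed (auto simp: adj_def)
  then show "?A ps" "?B ps" by auto
qed

lemma interp_Cons_fst:
  "mesh H ((a, ya) # ps) \<Longrightarrow> interp ((a, ya) # ps) a = ya"
  by (cases ps) auto

lemma mesh_fst_le: "mesh H (p # ps) \<Longrightarrow> q \<in> set ps \<Longrightarrow> fst p < fst q"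
  by (induction ps arbitrary: p) fastforce+

lemma interp_vertex:
  "mesh H ps \<Longrightarrow> (x, y) \<in> set ps \<Longrightarrow> interp ps x = y"
proof (induction ps rule: induct_list012)
  case (3 p q ps)
  obtain a ya b yb where p: "p = (a, ya)" and q: "q = (b, yb)" by fastforce
  have ab: "a < b" and m: "mesh H ((b, yb) # ps)" using 3 p q by auto
  consider "(x, y) = (a, ya)" | "(x, y) = (b, yb)" | "(x, y) \<in> set ps"
    using 3 p q by auto
  then show ?case
  proof cases
    case 3
    then have "b < x" using mesh_fst_le[OF m] by force
    then show ?thesis using "3.IH"(2) 3 p q m by simp
  qed (use p q ab in auto)
qed auto

text \<open>On each edge the refinement adds a tent over the middle third, of height
  \<open>lam\<close> times the edge length.\<close>

lemma interp_refine_step_diff: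
  assumes "lam \<ge> 0" and "H \<ge> 0"
  shows "mesh H ps \<Longrightarrow> ps \<noteq> [] \<Longrightarrow> fst (hd ps) \<le> x \<Longrightarrow>
    \<bar>interp (refine_step lam ps) x - interp ps x\<bar> \<le> lam * H"
proof (induction ps rule: induct_list012)
  case (2 p)
  then show ?case using assms by (cases p) auto
next
  case (3 p q ps)
  obtain a ya b yb where p: "p = (a, ya)" and q: "q = (b, yb)" by fastforce
  obtain qs where qs: "refine_step lam ((b, yb) # ps) = (b, yb) # qs"
    using refine_step_Cons by blast
  have ab: "a < b" and d: "dist (a, ya) (b, yb) \<le> H" and ax: "a \<le> x"
    using 3 p q by auto
  define D where "D = lam * dist (a, ya) (b, yb)"
  have D: "0 \<le> D" "D \<le> lam * H"
    using assms d by (auto simp: D_def mult_left_mono)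
  define l where "l = b - a"
  define k where "k = yb - ya"
  \<comment> \<open>In the relative position \<open>t\<close> the new breakpoints become
    \<open>1/3\<close>, \<open>1/2\<close> and \<open>2/3\<close>.\<close>
  define t where "t = (x - a) / l"
  have l: "l > 0" and b: "b = a + l" "yb = ya + k" and x: "x = a + t * l"
    using ab by (auto simp: l_def k_def t_def)
  have "t \<ge> 0" using ax l by (simp add: t_def)
  have *: "x \<le> a + l * c \<longleftrightarrow> t \<le> c" for c using l by (simp add: x mult.commute)
  show ?case
  proof (cases "x \<le> b")
    case False
    then have "\<bar>interp (refine_step lam (q # ps)) x - interp (q # ps) x\<bar> \<le> lam * H"
      using 3 q by auto
    moreover have "interp (refine_step lam (p # q # ps)) x = interp (refine_step lam (q # ps)) x"
    proof -
      have "\<not> x \<le> a + (b - a) / 3" "\<not> x \<le> a + (b - a) / 2" "\<not> x \<le> a + 2 * (b - a) / 3"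
        using False ab by (simp_all add: field_simps)
      then show ?thesis
        using False unfolding p q refine_step_pair[OF ab] qs
        by (simp only: interp.simps(1) if_False)
    qed
    ultimately show ?thesis using False p q by simp
  next
    case True
    have t1: "t \<le> 1" using *[of 1] True b by simp
    have old: "interp (p # q # ps) x = ya + k * t"
      using True l by (simp add: p q b x)
    have **: "x \<le> a + l / 3 \<longleftrightarrow> t \<le> 1/3" "x \<le> a + l / 2 \<longleftrightarrow> t \<le> 1/2"
      "x \<le> a + 2 * l / 3 \<longleftrightarrow> t \<le> 2/3" "x \<le> a + l \<longleftrightarrow> t \<le> 1"
      using *[of "1/3"] *[of "1/2"] *[of "2/3"] *[of 1] by (simp_all add: mult.commute)
    \<comment> \<open>The terms with \<open>D\<close> are the two sides of the tent: zero at
      \<open>1/3\<close> and \<open>2/3\<close>, equal to \<open>D\<close> at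
      \<open>1/2\<close>.\<close>
    have new: "interp (refine_step lam (p # q # ps)) x =
        (if t \<le> 1/3 then ya + k * t
         else if t \<le> 1/2 then ya + k * t + D * (6 * t - 2)
         else if t \<le> 2/3 then ya + k * t + D * (4 - 6 * t)
         else ya + k * t)"
      unfolding p q refine_step_pair[OF ab] qs D_def[symmetric] l_def[symmetric] k_def[symmetric]
      using True l t1 by (simp add: ** b, simp add: x field_simps)
    have "D * c \<le> lam * H \<and> 0 \<le> D * c" if "0 \<le> c" "c \<le> 1" for c
      using D that by (meson mult_left_le mult_nonneg_nonneg order_trans)
    from this[of "6 * t - 2"] this[of "4 - 6 * t"] show ?thesis
      unfolding old new using D by auto
  qed
qed auto

text \<open>The half-line lets the induction glue the first edge on \<open>{a..b}\<close> to the
  tail on \<open>{b..}\<close>; both are closed and the values agree at \<open>b\<close>.\<close>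

lemma continuous_interp:
  "mesh H ps \<Longrightarrow> ps \<noteq> [] \<Longrightarrow> continuous_on {fst (hd ps)..} (interp ps)"
proof (induction ps rule: induct_list012)
  case (2 p)
  have "interp [p] = (\<lambda>x. snd p)" by (cases p) auto
  then show ?case by simp
next
  case (3 p q ps)
  obtain a ya b yb where p: "p = (a, ya)" and q: "q = (b, yb)" by fastforce
  have ab: "a < b" and m: "mesh H ((b, yb) # ps)" using 3 p q by auto
  have "continuous_on {a..b} (\<lambda>x. ya + (yb - ya) / (b - a) * (x - a))"
    by (intro continuous_intros)
  then have "continuous_on {a..b} (interp (p # q # ps))"
    by (rule continuous_on_eq) (simp add: p q)
  moreover have "continuous_on {b..} (interp (q # ps))" using 3 q by auto
  then have "continuous_on {b..} (interp (p # q # ps))"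
    by (rule continuous_on_eq) (use ab interp_Cons_fst[OF m] in \<open>auto simp: p q\<close>)
  ultimately have "continuous_on ({a..b} \<union> {b..}) (interp (p # q # ps))"
    by (intro continuous_on_closed_Un) auto
  moreover have "{a..b} \<union> {b..} = {a..}" using ab by auto
  ultimately show ?case by (simp add: p)
qed auto

section \<open>Convergence to \<open>F\<close> and its continuity\<close>

context
  fixes lam :: real
  assumes lam: "1/6 < lam" "lam < 5/6"
begin

lemma mesh_vertices: "mesh ((1/6 + lam) ^ n) (vertices lam n)"
proof (induction n)
  case (Suc n)
  then show ?case
    using mesh_refine_step[OF _ Suc] lam by (simp add: vertices_def)
qed (simp add: vertices_def dist_Pair_Pair)

lemma hd_vertices: "\<exists>ps. vertices lam n = (0, 0) # ps"
proof (induction n)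
  case (Suc n)
  then show ?case
    using refine_step_Cons by (force simp: vertices_def)
qed (simp add: vertices_def)

lemma vertices_Suc: "vertices lam (Suc n) = refine_step lam (vertices lam n)"
  by (simp add: vertices_def)

lemma Fn_vertex: "(x, y) \<in> set (vertices lam n) \<Longrightarrow> Fn lam (n + k) x = y"
proof -
  assume "(x, y) \<in> set (vertices lam n)"
  then have "(x, y) \<in> set (vertices lam (n + k))"
    by (induction k) (use set_refine_step[OF mesh_vertices] in \<open>auto simp: vertices_Suc\<close>)
  then show ?thesis
    unfolding Fn_def using interp_vertex[OF mesh_vertices] by blast
qed

text \<open>Later generations keep every vertex, so the approximations are eventually constant there
  and \<open>F\<close> is known exactly.\<close>

lemma F_vertex: "(x, y) \<in> set (vertices lam n) \<Longrightarrow> F lam x = y"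
proof -
  assume "(x, y) \<in> set (vertices lam n)"
  then have "(\<lambda>k. Fn lam (k + n) x) \<longlonglongrightarrow> y"
    using Fn_vertex[of x y n] by (simp add: add.commute)
  then have "(\<lambda>k. Fn lam k x) \<longlonglongrightarrow> y" by (rule LIMSEQ_offset)
  then show ?thesis by (simp add: F_def limI)
qed

text \<open>Consecutive approximations differ by at most \<open>lam * (1/6 + lam) ^ n\<close>, a
  summable bound because \<open>lam < 5/6\<close>; the M-test applied to the telescoping series
  gives a uniform limit.\<close>

lemma continuous_F: "continuous_on {0..1} (F lam)"
proof -
  define f where "f = (\<lambda>n x. Fn lam (Suc n) x - Fn lam n x)"
  have "norm (f n x) \<le> lam * (1/6 + lam) ^ n" if "x \<in> {0..1}" for n x
    using interp_refine_step_diff[OF _ _ mesh_vertices[of n], of lam x] hd_vertices[of n] lam that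
    by (auto simp: f_def Fn_def vertices_Suc)
  moreover have "summable (\<lambda>n. lam * (1/6 + lam) ^ n)"
    using lam by (intro summable_mult summable_geometric) auto
  ultimately have "uniform_limit {0..1} (\<lambda>n x. \<Sum>i<n. f i x) (\<lambda>x. suminf (\<lambda>i. f i x)) sequentially"
    by (rule Weierstrass_m_test)
  moreover have "(\<Sum>i<n. f i x) = Fn lam n x" if "x \<in> {0..1}" for n x
    using that sum_lessThan_telescope[of "\<lambda>n. Fn lam n x" n]
    by (simp add: f_def, simp add: Fn_def vertices_def)
  ultimately have u: "uniform_limit {0..1} (Fn lam) (\<lambda>x. suminf (\<lambda>i. f i x)) sequentially"
    by (subst uniform_limit_cong'[symmetric]) auto
  have "suminf (\<lambda>i. f i x) = F lam x" if "x \<in> {0..1}" for x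
    unfolding F_def using tendsto_uniform_limitI[OF u that] by (simp add: limI)
  moreover have "continuous_on {0..1} (Fn lam n)" for n
  proof -
    have "continuous_on {0..} (Fn lam n)"
      using continuous_interp[OF mesh_vertices[of n]] hd_vertices[of n]
      unfolding Fn_def[abs_def] by auto
    then show ?thesis by (rule continuous_on_subset) auto
  qed
  then have "continuous_on {0..1} (\<lambda>x. suminf (\<lambda>i. f i x))"
    by (intro uniform_limit_theorem[OF _ u]) auto
  ultimately show ?thesis using continuous_on_eq by blast
qed

section \<open>Steep intervals around \<open>2/5\<close> and secants of every slope\<close>

text \<open>Always passing to the second of the four subintervals gives the intervals of generation \<open>n\<close>
  around the point \<open>2/5\<close>, which divides each of them in the ratio \<open>2 : 3\<close>.\<close>
lemma steep_adj:
  "\<exists>y m. m \<ge> 6 * lam * n \<and>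
     ((2/5 - 2/5 * (1/6) ^ n, y), (2/5 + 3/5 * (1/6) ^ n, y + m * (1/6) ^ n)) \<in> adj (vertices lam n)"
proof (induction n)
  case 0
  show ?case by (intro exI[of _ 0]) (simp add: vertices_def)
next
  case (Suc n)
  define l :: real where "l = (1/6) ^ n"
  obtain y m where m: "m \<ge> 6 * lam * n"
    and adj: "((2/5 - 2/5 * l, y), (2/5 + 3/5 * l, y + m * l)) \<in> adj (vertices lam n)"
    using Suc unfolding l_def by blast
  define d where "d = dist (2/5 - 2/5 * l, y) (2/5 + 3/5 * l, y + m * l)"
  have l: "l > 0" by (simp add: l_def)
  have "l = \<bar>fst (2/5 - 2/5 * l, y) - fst (2/5 + 3/5 * l, y + m * l)\<bar>"
    using l by simp
  also have "\<dots> \<le> d" unfolding d_def by (metis dist_fst_le dist_real_def)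
  finally have d: "d / l \<ge> 1" using l by simp
  \<comment> \<open>From the first third point to the midpoint the rise is
    \<open>m * l / 6 + lam * d\<close> over width \<open>l / 6\<close>, hence the slope
    \<open>?m\<close>. As \<open>d >= l\<close>, each generation adds at least
    \<open>6 * lam\<close>.\<close>
  let ?y = "y + m * l / 3" and ?m = "m + 6 * lam * (d / l)"
  have "((2/5 - 2/5 * (l / 6), ?y), (2/5 + 3/5 * (l / 6), ?y + ?m * (l / 6))) \<in> adj (vertices lam (Suc n))"
  proof -
    let ?a = "2/5 - 2/5 * l" and ?b = "2/5 + 3/5 * l" and ?z = "y + m * l"
    have "?a + (?b - ?a) / 3 = 2/5 - 2/5 * (l / 6)" "?a + (?b - ?a) / 2 = 2/5 + 3/5 * (l / 6)"
      "y + (?z - y) / 3 = ?y" "y + (?z - y) / 2 + lam * d = ?y + ?m * (l / 6)"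
      using l by (simp_all add: field_simps)
    then show ?thesis
      using adj_refine_step(2)[OF adj mesh_vertices, of lam]
      unfolding vertices_Suc d_def[symmetric] by (simp only:)
  qed
  moreover have "6 * lam * 1 \<le> 6 * lam * (d / l)"
    using d lam by (intro mult_left_mono) auto
  then have "?m \<ge> 6 * lam * Suc n" using m by (simp add: algebra_simps)
  ultimately show ?case
    by - (rule exI[where x = ?y], rule exI[where x = ?m], simp add: l_def)
qed

text \<open>Both outer thirds have slope \<open>m\<close>. The midpoint bound, from
  \<open>d >= \<bar>m\<bar> * l\<close>, shows that the edge right of the midpoint descends with
  slope at most \<open>m - 6 * lam * \<bar>m\<bar>\<close>.\<close>

lemma steep_F:
  fixes n :: nat
  defines "l \<equiv> (1/6) ^ n :: real"
  defines "a \<equiv> 2/5 - 2/5 * l"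
  obtains y m where "m \<ge> 6 * lam * n" and "F lam a = y"
    and "F lam (a + l / 3) = y + m * l / 3"
    and "F lam (a + l / 2) \<ge> y + m * l / 2 + lam * \<bar>m\<bar> * l"
    and "F lam (a + 2 * l / 3) = y + 2 * m * l / 3"
    and "F lam (a + l) = y + m * l"
proof -
  obtain y m where m: "m \<ge> 6 * lam * n"
    and "((2/5 - 2/5 * l, y), (2/5 + 3/5 * l, y + m * l)) \<in> adj (vertices lam n)"
    using steep_adj[of n] unfolding l_def by blast
  moreover have "2/5 + 3/5 * l = a + l" by (simp add: a_def)
  ultimately have adj: "((a, y), (a + l, y + m * l)) \<in> adj (vertices lam n)"
    by (simp only: a_def)
  define d where "d = dist (a, y) (a + l, y + m * l)"
  have l: "l > 0" by (simp add: l_def)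
  have "\<bar>m\<bar> * l = \<bar>snd (a, y) - snd (a + l, y + m * l)\<bar>"
    using l by (simp add: abs_mult)
  also have "\<dots> \<le> d" unfolding d_def by (metis dist_snd_le dist_real_def)
  finally have d: "lam * \<bar>m\<bar> * l \<le> lam * d" using lam by (simp add: mult.assoc)
  have *: "F lam x = z" if "(x, z) \<in> set (refine_step lam (vertices lam n))" for x z
    using F_vertex[of x z "Suc n"] that by (simp add: vertices_Suc)
  have **: "F lam a = y" "F lam (a + l / 3) = y + m * l / 3"
    "F lam (a + l / 2) = y + m * l / 2 + lam * d"
    "F lam (a + 2 * l / 3) = y + 2 * (m * l) / 3" "F lam (a + l) = y + m * l"
    using adj_refine_step(1)[OF adj mesh_vertices, of lam]
    by (auto intro!: * simp: d_def)
  show ?thesis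
    by (rule that[of m y]) (use m ** d in auto)
qed

lemma all_secant_slopes:
  obtains u v where "u \<in> {0..1}" "v \<in> {0..1}" "u < v" "F lam v - F lam u = s * (v - u)"
proof -
  \<comment> \<open>This size of \<open>n\<close> makes the ascending slope \<open>m\<close> at
    least \<open>s\<close>, and the descending slope at most \<open>s\<close>.\<close>
  obtain n :: nat where n: "n > \<bar>s\<bar> + 3 * \<bar>s\<bar> / (6 * lam - 1)"
    using reals_Archimedean2 by blast
  define l :: real where "l = (1/6) ^ n"
  define a where "a = 2/5 - 2/5 * l"
  obtain y m where m: "m \<ge> 6 * lam * n" and F: "F lam a = y"
    "F lam (a + l / 3) = y + m * l / 3"
    "F lam (a + l / 2) \<ge> y + m * l / 2 + lam * \<bar>m\<bar> * l"
    "F lam (a + 2 * l / 3) = y + 2 * m * l / 3"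
    using steep_F[of n] unfolding l_def a_def by metis
  have l: "l > 0" "l \<le> 1" by (auto simp: l_def power_le_one)
  have "n \<le> 6 * lam * n" using lam by (simp add: mult_le_cancel_right1)
  moreover have "3 * \<bar>s\<bar> / (6 * lam - 1) \<ge> 0" using lam by simp
  ultimately have ms: "m \<ge> \<bar>s\<bar>" "m > 3 * \<bar>s\<bar> / (6 * lam - 1)"
    using m n by linarith+
  then have ms': "(6 * lam - 1) * m \<ge> 3 * \<bar>s\<bar>"
    using lam by (simp add: field_simps)
  \<comment> \<open>The chord slides from the first third (\<open>t = 0\<close>) to the edge right
    of the midpoint (\<open>t = 1\<close>), keeping positive width. A zero of \<open>h\<close> is a
    chord of slope \<open>s\<close>, so the intermediate value theorem applies.\<close>
  define u where "u t = a + t * (l / 2)" for t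
  define v where "v t = a + l / 3 + t * (l / 3)" for t
  define h where "h t = F lam (v t) - F lam (u t) - s * (v t - u t)" for t
  have ran: "u t \<in> {0..1}" "v t \<in> {0..1}" "u t < v t" if "t \<in> {0..1}" for t
  proof -
    have "0 \<le> t * l" "t * l \<le> l" using that l by (auto simp: mult_left_le_one_le)
    then show "u t \<in> {0..1}" "v t \<in> {0..1}" "u t < v t"
      using l unfolding u_def v_def a_def atLeastAtMost_iff times_divide_eq_right by linarith+
  qed
  have "continuous_on {0..1} (\<lambda>t. F lam (u t))" "continuous_on {0..1} (\<lambda>t. F lam (v t))"
    by (intro continuous_on_compose2[OF continuous_F]; use ran in
        \<open>force simp: u_def v_def intro!: continuous_intros\<close>)+
  then have c: "continuous_on {0..1} h"
    unfolding h_def u_def v_def by (intro continuous_intros)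
  have h0: "h 0 = (m - s) * (l / 3)" using F by (simp add: h_def u_def v_def algebra_simps)
  have "h 1 \<le> (- (6 * lam - 1) * \<bar>m\<bar> - s) * (l / 6)"
    using F ms by (simp add: h_def u_def v_def algebra_simps)
  moreover have "- (6 * lam - 1) * \<bar>m\<bar> - s \<le> 0" using ms ms' by (simp add: algebra_simps)
  then have "(- (6 * lam - 1) * \<bar>m\<bar> - s) * (l / 6) \<le> 0"
    using l by (intro mult_nonpos_nonneg) auto
  ultimately have "h 1 \<le> 0" by simp
  moreover have "h 0 \<ge> 0" unfolding h0 using ms l by (intro mult_nonneg_nonneg) auto
  ultimately obtain t where "t \<in> {0..1}" "h t = 0"
    using IVT2'[of h 1 0 0] c by auto
  then show ?thesis using ran[of t] that[of "u t" "v t"] by (simp add: h_def)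
qed

section \<open>Similarities that map the graph into itself\<close>

lemma similarity_preserves_vertical:
  assumes \<Phi>: "contracting_similarity \<Phi>" and sub: "\<Phi> ` graph_F lam \<subseteq> graph_F lam"
  obtains c e where "0 < \<bar>e\<bar>" "\<bar>e\<bar> < 1" "\<And>p. fst (\<Phi> p) = c + e * fst p"
    "\<And>p q. \<bar>snd (\<Phi> p) - snd (\<Phi> q)\<bar> = \<bar>e\<bar> * \<bar>snd p - snd q\<bar>"
proof -
  obtain r where r: "0 < r" "r < 1" and \<Phi>r: "\<And>p q. dist (\<Phi> p) (\<Phi> q) = r * dist p q"
    using \<Phi> unfolding contracting_similarity_def by blast
  \<comment> \<open>Removing the ratio and the translation leaves an isometry fixing the origin,
    which is linear and orthogonal.\<close>
  define T where "T p = (1 / r) *\<^sub>R (\<Phi> p - \<Phi> 0)" for p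
  have "dist (T p) (T q) = dist p q" for p q
  proof -
    have "T p - T q = (1 / r) *\<^sub>R (\<Phi> p - \<Phi> q)"
      by (simp add: T_def algebra_simps)
    then show ?thesis using r \<Phi>r[of p q] by (simp add: dist_norm)
  qed
  then have "orthogonal_transformation T"
    by (simp add: orthogonal_transformation_isometry T_def)
  then have lin: "linear T" and inner: "\<And>p q. T p \<bullet> T q = p \<bullet> q"
    unfolding orthogonal_transformation_def by blast+
  define \<alpha> \<beta> \<gamma> \<delta> where "\<alpha> = fst (T (1, 0))" and "\<beta> = snd (T (1, 0))"
    and "\<gamma> = fst (T (0, 1))" and "\<delta> = snd (T (0, 1))"
  have T: "T p = (\<alpha> * fst p + \<gamma> * snd p, \<beta> * fst p + \<delta> * snd p)" for p
  proof -
    have "T p = T (fst p *\<^sub>R (1, 0) + snd p *\<^sub>R (0, 1))" by simp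
    also have "\<dots> = fst p *\<^sub>R T (1, 0) + snd p *\<^sub>R T (0, 1)"
      by (simp only: linear_add[OF lin] linear_scale[OF lin])
    finally show ?thesis by (simp add: prod_eq_iff \<alpha>_def \<beta>_def \<gamma>_def \<delta>_def)
  qed
  have \<Phi>T: "\<Phi> p = \<Phi> 0 + r *\<^sub>R T p" for p using r by (simp add: T_def)
  have orth: "\<alpha>\<^sup>2 + \<beta>\<^sup>2 = 1" "\<gamma>\<^sup>2 + \<delta>\<^sup>2 = 1" "\<alpha> * \<gamma> + \<beta> * \<delta> = 0"
    using inner[of "(1, 0)" "(1, 0)"] inner[of "(0, 1)" "(0, 1)"] inner[of "(1, 0)" "(0, 1)"]
    by (simp_all add: T power2_eq_square)
  \<comment> \<open>If \<open>\<gamma>\<close> were nonzero, directions of slope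
    \<open>- \<alpha> / \<gamma>\<close> would become vertical. Some secant has that slope, and its
    two endpoints would be mapped to graph points with equal abscissas, hence to the same point,
    against injectivity.\<close>
  have \<gamma>: "\<gamma> = 0"
  proof (rule ccontr)
    assume "\<gamma> \<noteq> 0"
    obtain u v where uv: "u \<in> {0..1}" "v \<in> {0..1}" "u < v"
      and s: "F lam v - F lam u = (- \<alpha> / \<gamma>) * (v - u)"
      by (rule all_secant_slopes)
    define p q where "p = (u, F lam u)" and "q = (v, F lam v)"
    have "p \<in> graph_F lam" "q \<in> graph_F lam"
      using uv by (auto simp: p_def q_def graph_F_def)
    then have gr: "\<Phi> p \<in> graph_F lam" "\<Phi> q \<in> graph_F lam" using sub by auto
    have "\<alpha> * (v - u) + \<gamma> * (F lam v - F lam u) = 0"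
      using \<open>\<gamma> \<noteq> 0\<close> unfolding s by simp
    then have "fst (T p) = fst (T q)" by (simp add: T p_def q_def algebra_simps)
    then have "fst (\<Phi> p) = fst (\<Phi> q)" unfolding \<Phi>T[of p] \<Phi>T[of q] by simp
    then have "\<Phi> p = \<Phi> q" using gr by (auto simp: graph_F_def)
    then have "p = q" using \<Phi>r[of p q] r by simp
    then show False using uv by (simp add: p_def q_def)
  qed
  \<comment> \<open>Now the second column is a vertical unit vector, and orthogonality of the
    columns forces the first to be horizontal.\<close>
  then have "\<delta> \<noteq> 0" "\<bar>\<delta>\<bar> = 1" using orth by (auto simp: power2_eq_1_iff)
  then have \<beta>: "\<beta> = 0" and \<alpha>: "\<bar>\<alpha>\<bar> = 1" using orth \<gamma> by (auto simp: power2_eq_1_iff)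
  show ?thesis
  proof (rule that[of "r * \<alpha>" "fst (\<Phi> 0)"])
    show "0 < \<bar>r * \<alpha>\<bar>" "\<bar>r * \<alpha>\<bar> < 1" using r \<alpha> by (simp_all add: abs_mult)
    show "fst (\<Phi> p) = fst (\<Phi> 0) + r * \<alpha> * fst p" for p
      unfolding \<Phi>T[of p] by (simp add: T \<gamma>)
    show "\<bar>snd (\<Phi> p) - snd (\<Phi> q)\<bar> = \<bar>r * \<alpha>\<bar> * \<bar>snd p - snd q\<bar>" for p q
    proof -
      have "snd (\<Phi> p) - snd (\<Phi> q) = r * \<delta> * (snd p - snd q)"
        unfolding \<Phi>T[of p] \<Phi>T[of q] by (simp add: T \<beta> algebra_simps)
      then show ?thesis using \<alpha> \<open>\<bar>\<delta>\<bar> = 1\<close> by (simp add: abs_mult)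
    qed
  qed
qed

text \<open>The trace of such a similarity on the abscissas; a negative \<open>e\<close> is a
  horizontal reflection. Absolute increments hide a vertical reflection and suffice for bounding
  oscillation.\<close>

definition copy :: "real \<Rightarrow> real \<Rightarrow> bool" where
  "copy c e \<longleftrightarrow> (\<forall>t\<in>{0..1}. c + e * t \<in> {0..1}) \<and>
     (\<forall>t\<in>{0..1}. \<forall>t'\<in>{0..1}. \<bar>F lam (c + e * t) - F lam (c + e * t')\<bar> = \<bar>e\<bar> * \<bar>F lam t - F lam t'\<bar>)"

lemma copy_compose: "copy c e \<Longrightarrow> copy c' e' \<Longrightarrow> copy (c + e * c') (e * e')"
proof -
  assume *: "copy c e" "copy c' e'"
  have eq: "(c + e * c') + (e * e') * t = c + e * (c' + e' * t)" for t
    by (simp add: algebra_simps)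
  show ?thesis using * unfolding copy_def eq by (simp add: abs_mult)
qed

lemma similarity_copy:
  assumes "contracting_similarity \<Phi>" and sub: "\<Phi> ` graph_F lam \<subseteq> graph_F lam"
  obtains c e where "0 < \<bar>e\<bar>" "\<bar>e\<bar> < 1" "copy c e" "\<And>p. fst (\<Phi> p) = c + e * fst p"
proof -
  obtain c e where e: "0 < \<bar>e\<bar>" "\<bar>e\<bar> < 1" and fst: "\<And>p. fst (\<Phi> p) = c + e * fst p"
    and snd: "\<And>p q. \<bar>snd (\<Phi> p) - snd (\<Phi> q)\<bar> = \<bar>e\<bar> * \<bar>snd p - snd q\<bar>"
    using similarity_preserves_vertical[OF assms] by metis
  have *: "c + e * t \<in> {0..1} \<and> F lam (c + e * t) = snd (\<Phi> (t, F lam t))" if "t \<in> {0..1}" for t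
  proof -
    have "\<Phi> (t, F lam t) \<in> graph_F lam" using that sub by (auto simp: graph_F_def)
    then show ?thesis using fst[of "(t, F lam t)"] by (auto simp: graph_F_def)
  qed
  then have "copy c e" unfolding copy_def using snd by simp
  then show ?thesis using that e fst by blast
qed

section \<open>Arbitrarily small copies around a point, and the contradiction at
  \<open>2/5\<close>\<close>

text \<open>The point over \<open>x\<close> lies in the image of some piece; the induction
  hypothesis applies to its preimage, and composing with that piece multiplies the ratio by at most
  \<open>\<rho> < 1\<close>.\<close>

lemma small_copies:
  assumes \<Phi>s: "\<forall>\<Phi>\<in>set \<Phi>s. contracting_similarity \<Phi>"
    and gr: "graph_F lam = (\<Union>\<Phi>\<in>set \<Phi>s. \<Phi> ` graph_F lam)"
    and x: "x \<in> {0..1}" and \<epsilon>: "\<epsilon> > 0"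
  obtains c e t where "copy c e" "0 < \<bar>e\<bar>" "\<bar>e\<bar> < \<epsilon>" "t \<in> {0..1}" "x = c + e * t"
proof -
  have "\<exists>c e. 0 < \<bar>e\<bar> \<and> \<bar>e\<bar> < 1 \<and> copy c e \<and> (\<forall>p. fst (\<Phi> p) = c + e * fst p)" if "\<Phi> \<in> set \<Phi>s" for \<Phi>
    using similarity_copy[of \<Phi>] \<Phi>s gr that by (metis UN_upper)
  then obtain c e where ce: "\<And>\<Phi>. \<Phi> \<in> set \<Phi>s \<Longrightarrow> 0 < \<bar>e \<Phi>\<bar> \<and> \<bar>e \<Phi>\<bar> < 1 \<and> copy (c \<Phi>) (e \<Phi>) \<and>
      (\<forall>p. fst (\<Phi> p) = c \<Phi> + e \<Phi> * fst p)"
    by metis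
  \<comment> \<open>Finiteness of the family bounds all ratios away from 1. Inserting 0 covers the
    empty list and gives \<open>\<rho> >= 0\<close>.\<close>
  define \<rho> where "\<rho> = Max (insert 0 ((\<lambda>\<Phi>. \<bar>e \<Phi>\<bar>) ` set \<Phi>s))"
  have \<rho>: "0 \<le> \<rho>" "\<rho> < 1" and \<rho>_ge: "\<And>\<Phi>. \<Phi> \<in> set \<Phi>s \<Longrightarrow> \<bar>e \<Phi>\<bar> \<le> \<rho>"
    using ce by (auto simp: \<rho>_def)
  have "\<exists>c e t. copy c e \<and> 0 < \<bar>e\<bar> \<and> \<bar>e\<bar> \<le> \<rho> ^ n \<and> t \<in> {0..1} \<and> x = c + e * t"
    if "x \<in> {0..1}" for n x
    using that
  proof (induction n arbitrary: x)
    case 0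
    then show ?case
      by (intro exI[of _ 0] exI[of _ 1] exI[of _ x]) (auto simp: copy_def)
  next
    case (Suc n)
    then have "(x, F lam x) \<in> graph_F lam" by (auto simp: graph_F_def)
    then have "(x, F lam x) \<in> (\<Union>\<Phi>\<in>set \<Phi>s. \<Phi> ` graph_F lam)" by (subst gr[symmetric])
    then obtain \<Phi> p where \<Phi>: "\<Phi> \<in> set \<Phi>s" and p: "p \<in> graph_F lam" "\<Phi> p = (x, F lam x)"
      by (elim UN_E imageE) metis
    have "fst p \<in> {0..1}" using p by (auto simp: graph_F_def)
    then obtain c' e' t where IH: "copy c' e'" "0 < \<bar>e'\<bar>" "\<bar>e'\<bar> \<le> \<rho> ^ n" "t \<in> {0..1}" "fst p = c' + e' * t"
      using Suc.IH by blast
    have "x = c \<Phi> + e \<Phi> * fst p" using ce[OF \<Phi>] p by (metis fst_conv)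
    then have "x = (c \<Phi> + e \<Phi> * c') + (e \<Phi> * e') * t" by (simp add: IH algebra_simps)
    moreover have "\<bar>e \<Phi> * e'\<bar> \<le> \<rho> ^ Suc n"
      using \<rho>_ge[OF \<Phi>] IH \<rho> by (simp add: abs_mult mult_mono)
    moreover have "0 < \<bar>e \<Phi> * e'\<bar>" using ce[OF \<Phi>] IH by (simp add: abs_mult)
    ultimately show ?case
      using copy_compose[of "c \<Phi>" "e \<Phi>" c' e'] ce[OF \<Phi>] IH by blast
  qed
  moreover obtain n where "\<rho> ^ n < \<epsilon>" using real_arch_pow_inv[OF \<epsilon> \<rho>(2)] by blast
  ultimately show ?thesis using x that by (meson order_le_less_trans)
qed

lemma not_self_similar:
  assumes \<Phi>s: "\<forall>\<Phi>\<in>set \<Phi>s. contracting_similarity \<Phi>"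
    and gr: "graph_F lam = (\<Union>\<Phi>\<in>set \<Phi>s. \<Phi> ` graph_F lam)"
  shows False
proof -
  have "bounded (F lam ` {0..1})"
    by (intro compact_imp_bounded compact_continuous_image continuous_F) auto
  then obtain B0 where B0: "\<And>t. t \<in> {0..1} \<Longrightarrow> \<bar>F lam t\<bar> \<le> B0"
    unfolding bounded_iff real_norm_def by blast
  define B where "B = 2 * B0"
  have B: "\<bar>F lam t - F lam t'\<bar> \<le> B" if "t \<in> {0..1}" "t' \<in> {0..1}" for t t'
    using B0[OF that(1)] B0[OF that(2)] unfolding B_def by linarith
  have B_nn: "B \<ge> 0" using B[of 0 0] by simp
  \<comment> \<open>The oscillation bound below will give \<open>m <= 36 * B\<close>, whereas
    steepness gives \<open>m >= 6 * lam * k >= k > N\<close>.\<close>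
  obtain N :: nat where N: "N > 36 * B" using reals_Archimedean2 by blast
  obtain c e t where ce: "copy c e" "0 < \<bar>e\<bar>" "\<bar>e\<bar> < (1/6) ^ N" "t \<in> {0..1}" "2/5 = c + e * t"
    using small_copies[OF assms, of "2/5" "(1/6) ^ N"] by auto
  define I where "I = (\<lambda>t. c + e * t) ` {0..1}"
  have osc: "\<bar>F lam z - F lam z'\<bar> \<le> \<bar>e\<bar> * B" if "z \<in> I" "z' \<in> I" for z z'
    using that ce(1) B unfolding I_def copy_def by (force intro!: mult_left_mono)
  have I: "I = (if e \<ge> 0 then {c..c + e} else {c + e..c})"
    unfolding I_def using image_affinity_atLeastAtMost[of e c 0 1] by (simp add: add.commute)
  obtain k0 where "(1/6 :: real) ^ k0 \<le> \<bar>e\<bar> / 2"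
    using real_arch_pow_inv[of "\<bar>e\<bar> / 2" "1/6"] ce by (auto intro: less_imp_le)
  \<comment> \<open>The first generation whose interval around \<open>2/5\<close> has at most half
    the length of \<open>I\<close>. By minimality \<open>l\<close> is also comparable to
    \<open>\<bar>e\<bar>\<close> from below.\<close>
  define k where "k = (LEAST k. (1/6 :: real) ^ k \<le> \<bar>e\<bar> / 2)"
  define l :: real where "l = (1/6) ^ k"
  have k: "l \<le> \<bar>e\<bar> / 2"
    unfolding k_def l_def by (rule LeastI) fact
  have "k > N"
  proof (rule ccontr)
    assume "\<not> k > N"
    then have "(1/6) ^ N \<le> l" unfolding l_def by (intro power_decreasing) auto
    then show False using ce k by linarith
  qed
  \<comment> \<open>Minimality is used at \<open>k - 1\<close>, a genuine predecessor since
    \<open>k > N\<close> makes \<open>k\<close> positive.\<close>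
  then have "\<not> (1/6 :: real) ^ (k - 1) \<le> \<bar>e\<bar> / 2"
    unfolding k_def by (intro not_less_Least) (use \<open>k > N\<close> in \<open>simp add: k_def\<close>)
  moreover have "(1/6 :: real) ^ (k - 1) = 6 * l"
    using \<open>k > N\<close> by (cases k) (auto simp: l_def)
  ultimately have l: "\<bar>e\<bar> < 12 * l" by simp
  define a where "a = 2/5 - 2/5 * l"
  obtain y m where m: "m \<ge> 6 * lam * k" and F: "F lam a = y"
    "F lam (a + l / 3) = y + m * l / 3"
    "F lam (a + 2 * l / 3) = y + 2 * m * l / 3"
    "F lam (a + l) = y + m * l"
    using steep_F[of k] unfolding l_def a_def by metis
  have l0: "l > 0" by (simp add: l_def)
  \<comment> \<open>\<open>I\<close> contains \<open>2/5\<close> and has length at least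
    \<open>2 * l\<close>, so it reaches \<open>l\<close> or more to one side. As
    \<open>2/5 = a + 2 * l / 5\<close>, the left side then contains the first third of the steep
    interval, or the right side the last third.\<close>
  have "(a \<in> I \<and> a + l / 3 \<in> I) \<or> (a + 2 * l / 3 \<in> I \<and> a + l \<in> I)"
  proof (cases "e \<ge> 0")
    case True
    then have "0 \<le> e * t" "e * t \<le> e" using ce(4) by (auto simp: mult_left_le)
    then show ?thesis
      using True k l0 ce(5) unfolding I if_P[OF True] a_def atLeastAtMost_iff by linarith
  next
    case False
    then have "e * t \<le> 0" "e \<le> e * t"
      using ce(4) mult_left_mono_neg[of t 1 e] by (auto simp: mult_nonpos_nonneg)
    then show ?thesis
      using False k l0 ce(5) unfolding I if_not_P[OF False] a_def atLeastAtMost_iff by linarith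
  qed
  moreover have "F lam (a + l / 3) - F lam a = m * l / 3"
    "F lam (a + l) - F lam (a + 2 * l / 3) = m * l / 3"
    using F by auto
  ultimately have "m * l / 3 \<le> \<bar>e\<bar> * B"
    using osc by (metis abs_ge_self order_trans)
  also have "\<dots> \<le> 12 * l * B" using l B_nn by (intro mult_right_mono) auto
  finally have "m \<le> 36 * B" using l0 by (simp add: field_simps)
  moreover have "N \<le> 6 * lam * k"
  proof -
    have "1 * real k \<le> 6 * lam * real k" using lam by (intro mult_right_mono) auto
    then show ?thesis using \<open>k > N\<close> by linarith
  qed
  ultimately show False using m N by linarith
qed

end

theorem theorem1p4:
  fixes lam :: real
  assumes "1/6 < lam" and "lam < 5/6"
  shows "\<not> (\<exists>\<Phi>s :: (real \<times> real \<Rightarrow> real \<times> real) list.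
            \<Phi>s \<noteq> [] \<and> (\<forall>\<Phi>\<in>set \<Phi>s. contracting_similarity \<Phi>) \<and>
            graph_F lam = (\<Union>\<Phi>\<in>set \<Phi>s. \<Phi> ` graph_F lam))"
  using not_self_similar[OF assms] by blast

end
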